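(* There exist a constant $C_1(\ell)>0$ for each integer $\ell\ge 1$ (depending only on $\ell$), and an absolute constant $C_3>0$, such that, with $C_2:=32\pi e$, the following holds. Let $\ell\ge 1$ be an integer, and let $\mathcal{X}=\{x_1,\dots,x_\ell\}\subset(-\pi,\pi]$ form a $(\Delta,\ell,\tau)_{\mathbb{T}}$-cluster. Then for any integer $N$ satisfying $C_1(\ell)\le N\le \frac{2\pi}{\tau\Delta}$, $$\sigma_{\min}\bigl(\mathbf{V}_N(\mathcal{X})\bigr)\ \ge\ C_3\,\sqrt{N}\,\Bigl(\frac{N\Delta}{C_2}\Bigr)^{\ell-1}.$$
   Context: For a finite set of $s$ distinct nodes $\mathcal{X}=\{x_1,\dots,x_s\}\subset(-\pi,\pi]$ and an integer $N\ge s-1$, $\mathbf{V}_N(\mathcal{X})$ is the $(N+1)\times s$ Vandermonde matrix $\mathbf{V}_N(\mathcal{X})=\bigl[e^{\imath k x_j}\bigr]_{0\le k\le N}^{1\le j\le s}$ (rows indexed by $k$, columns by $j$), and $\sigma_{\min}(\mathbf{V}_N(\mathcal{X}))=\min_{\mathbf{c}\in\mathbb{C}^s,\ \|\mathbf{c}\|_2=1}\|\mathbf{V}_N(\mathcal{X})\mathbf{c}\|_2$ is its smallest singular value. Wrap-around distance: for $x,y\in\mathbb{R}$, $d(x,y):=\bigl|\operatorname{Arg}\exp(\imath(x-y))\bigr|\in[0,\pi]$, where $\operatorname{Arg}$ is the principal argument with values in $(-\pi,\pi]$. A set $\mathcal{X}=\{x_1,\dots,x_\ell\}\subset(-\pi,\pi]$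 of $\ell$ distinct nodes forms a $(\Delta,\ell,\tau)_{\mathbb{T}}$-cluster (equivalently, a $(\Delta,\ell,\tau)_{\mathbb{T}}$-clustered configuration), where $\Delta>0$ and $\ell-1\le\tau\le\frac{\pi}{\Delta}$, if $\Delta\le d(x,y)\le\tau\Delta$ for all $x,y\in\mathcal{X}$ with $x\ne y$. If $\tau=0$ (possible only for $\ell=1$), the bound $N\le\frac{2\pi}{\tau\Delta}$ is read as no upper restriction on $N$. *)

theory Defs
  imports "HOL-Analysis.Analysis" "Jordan_Normal_Form.Matrix"
begin

unbundle no vec_syntax
no_notation inner (infix \<open>\<bullet>\<close> 70)

(* A finite node set enters the matrix through a list of its elements, the ordering being the
   enumeration x_1, ..., x_s; entry j (counted from 0) is the node x_(j+1). *)

definition vandermonde :: "nat \<Rightarrow> real list \<Rightarrow> complex mat" where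
  "vandermonde N xs =
     mat (N + 1) (length xs) (\<lambda>(k, j). exp (\<i> * of_nat k * complex_of_real (xs ! j)))"

definition norm2 :: "complex vec \<Rightarrow> real" where
  "norm2 v = L2_set (\<lambda>i. cmod (v $ i)) {..<dim_vec v}"

(* The infimum is a minimum as soon as the matrix has a column: see sigma_min_attained. *)
definition sigma_min :: "complex mat \<Rightarrow> real" where
  "sigma_min A = (INF c \<in> {c \<in> carrier_vec (dim_col A). norm2 c = 1}. norm2 (A *\<^sub>v c))"

definition wrap_dist :: "real \<Rightarrow> real \<Rightarrow> real" where
  "wrap_dist x y = \<bar>Arg (exp (\<i> * complex_of_real (x - y)))\<bar>"

definition clustered :: "real \<Rightarrow> nat \<Rightarrow> real \<Rightarrow> real set \<Rightarrow> bool" where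
  "clustered \<Delta> l \<tau> X \<longleftrightarrow>
     finite X \<and> card X = l \<and> X \<subseteq> {-pi<..pi} \<and>
     \<Delta> > 0 \<and> real l - 1 \<le> \<tau> \<and> \<tau> \<le> pi / \<Delta> \<and>
     (\<forall>x\<in>X. \<forall>y\<in>X. x \<noteq> y \<longrightarrow> \<Delta> \<le> wrap_dist x y \<and> wrap_dist x y \<le> \<tau> * \<Delta>)"

lemma norm2_mult_vec:
  "norm2 (A *\<^sub>v vec (dim_col A) f) =
     L2_set (\<lambda>i. cmod (\<Sum>j<dim_col A. A $$ (i, j) * f j)) {..<dim_row A}"
  by (auto simp: norm2_def scalar_prod_def lessThan_atLeast0 intro!: L2_set_cong sum.cong arg_cong[where f = cmod])

lemma sigma_min_attained:
  assumes "dim_col A > 0"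
  obtains c where "c \<in> carrier_vec (dim_col A)" "norm2 c = 1"
    and "sigma_min A = norm2 (A *\<^sub>v c)"
    and "\<And>b. b \<in> carrier_vec (dim_col A) \<Longrightarrow> norm2 b = 1 \<Longrightarrow> sigma_min A \<le> norm2 (A *\<^sub>v b)"
proof -
  define n where "n = dim_col A"
  define B :: "(nat \<Rightarrow> complex) set" where
    "B = PiE UNIV (\<lambda>i. if i < n then cball 0 1 else {0})"
  define S where "S = B \<inter> {f. L2_set (\<lambda>i. cmod (f i)) {..<n} = 1}"
  define g where "g f = norm2 (A *\<^sub>v vec n f)" for f
  have "compactin (product_topology (\<lambda>_::nat. euclidean :: complex topology) UNIV) B"
    unfolding B_def by (subst compactin_PiE) auto
  then have B: "compact B"
    by (simp add: euclidean_product_topology)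
  have coord: "continuous_on UNIV (\<lambda>f::nat \<Rightarrow> complex. f i)" for i
    by (rule continuous_on_product_coordinates)
  have "closed {f::nat \<Rightarrow> complex. L2_set (\<lambda>i. cmod (f i)) {..<n} = 1}"
    unfolding L2_set_def by (intro closed_Collect_eq continuous_intros coord)
  then have S: "compact S"
    unfolding S_def using B by (rule compact_Int_closed[rotated])
  have norm_vec: "norm2 (vec n f) = L2_set (\<lambda>i. cmod (f i)) {..<n}" for f
    by (auto simp: norm2_def intro!: L2_set_cong)
  have "(\<Sum>i<n. (cmod (if i = 0 then 1 else 0))\<^sup>2) = (\<Sum>i<n. if i = 0 then 1 else 0)"
    by (rule sum.cong) auto
  then have "(\<lambda>i. if i = 0 then 1 else 0) \<in> S"
    using assms by (auto simp: S_def B_def n_def L2_set_def)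
  then have ne: "S \<noteq> {}" by blast
  have "continuous_on S g"
    unfolding g_def n_def norm2_mult_vec L2_set_def
    by (intro continuous_intros continuous_on_subset[OF coord]) auto
  from continuous_attains_inf[OF S ne this] obtain f where f: "f \<in> S" "\<And>h. h \<in> S \<Longrightarrow> g f \<le> g h"
    by blast
  have low: "norm2 (A *\<^sub>v vec n f) \<le> norm2 (A *\<^sub>v b)" if b: "b \<in> carrier_vec n" "norm2 b = 1" for b
  proof -
    define h where "h i = (if i < n then b $ i else 0)" for i
    have bh: "b = vec n h" using b by (auto simp: h_def)
    have l: "L2_set (\<lambda>i. cmod (h i)) {..<n} = 1" using b bh norm_vec by metis
    have "cmod (h i) \<le> 1" if "i < n" for i
      using member_le_L2_set[of "{..<n}" i "\<lambda>i. cmod (h i)"] l that by simp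
    then have "h \<in> S" using l by (auto simp: S_def B_def h_def)
    then show ?thesis using f(2) unfolding g_def bh by blast
  qed
  have c: "vec n f \<in> carrier_vec n" "norm2 (vec n f) = 1"
    using f(1) norm_vec by (auto simp: S_def)
  have eq: "sigma_min A = norm2 (A *\<^sub>v vec n f)"
    unfolding sigma_min_def n_def[symmetric]
    using c low by (intro cInf_eq_minimum) auto
  show ?thesis
    by (rule that[of "vec n f"]) (use c eq low n_def in auto)
qed

end

theory Submission
  imports Defs
begin

text \<open>
  Write \<open>n = l - 1\<close> and \<open>z\<^sub>y = exp (\<i> y)\<close> for the nodes \<open>y\<close>. For a coefficient vector \<open>c\<close> of norm 1, the
  entries of \<open>V c\<close> are the values at \<open>0, \<dots>, N\<close> of the exponential sum \<open>f k = \<Sum>y. c\<^sub>y z\<^sub>y ^ k\<close>, so the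
  claim says that the \<open>\<ell>\<^sup>2\<close> norm of \<open>f\<close> cannot be too small.

  To isolate one coefficient \<open>c\<^sub>x\<close>, let \<open>S\<close> be the shift of sequences and apply \<open>S ^ m - z\<^sub>y ^ m\<close> to \<open>f\<close> for
  every node \<open>y \<noteq> x\<close>. Each operator at most doubles the \<open>\<ell>\<^sup>2\<close> norm and shortens the window by \<open>m\<close>; what
  remains is the geometric sequence with ratio \<open>z\<^sub>x\<close> and coefficient
  \<open>c\<^sub>x (\<Prod>y \<noteq> x. z\<^sub>x ^ m - z\<^sub>y ^ m)\<close> (\<open>cmod_coeff_mult_prod_le\<close>). The step is \<open>m \<approx> N / (2 n)\<close>: a long step
  magnifies the small distances between the nodes, while half of the window survives and contributes
  the factor \<open>sqrt (N / 2)\<close>. The upper bound on \<open>N\<close> keeps the magnified differences of the arguments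
  within \<open>pi\<close>, where a chord is comparable with its arc, so that
  \<open>\<bar>z\<^sub>x ^ m - z\<^sub>y ^ m\<bar> \<ge> (2 m / pi) d(x, y)\<close> (\<open>cmod_exp_power_diff_ge\<close>).

  With \<open>m\<close> of size \<open>N / n\<close>, the product of these factors seems to lose \<open>n ^ n\<close>. Separation gives it back:
  seen from \<open>x\<close>, the other nodes have arguments that are separated by \<open>\<Delta>\<close> on the real line, so on each
  side the \<open>i\<close>-th nearest one is at distance at least \<open>i \<Delta>\<close>, and the product of all distances is at
  least \<open>\<Delta> ^ n a! b!\<close> with \<open>a + b = n\<close>, hence at least \<open>(\<Delta> n / (2 e)) ^ n\<close> (\<open>prod_wrap_dist_ge\<close>).

  Altogether \<open>\<bar>c\<^sub>x\<bar> sqrt (N / 2) (N \<Delta> / (8 pi e)) ^ n\<close> is at most the norm of \<open>f\<close>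
  (\<open>clustered_coeff_le\<close>). Summing the squares over \<open>x\<close> costs a factor \<open>sqrt l\<close>, and it is paid by the
  \<open>4 ^ n\<close> that separates \<open>8 pi e\<close> from \<open>32 pi e\<close>; the remaining constant \<open>1 / sqrt 2\<close> is absolute.
\<close>

section \<open>Products of separated reals\<close>

text \<open>The left-hand side, divided by \<open>fact n\<close>, is one term of the series for \<open>exp n\<close>.\<close>
lemma power_le_exp_fact: "real n ^ n \<le> exp 1 ^ n * fact n"
proof -
  have "real n ^ n / fact n \<le> (\<Sum>k. real n ^ k / fact k)"
    using sum_le_suminf[OF summable_exp_generic[of "real n"], of "{n}"]
    by (simp add: divide_inverse mult.commute)
  also have "\<dots> = exp (real n)"
    by (simp add: exp_def divide_inverse mult.commute)
  finally show ?thesis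
    by (simp add: field_simps flip: exp_of_nat_mult)
qed

text \<open>
  The product differs from \<open>fact (a + b)\<close> by a binomial coefficient, hence by at most
  \<open>2 ^ (a + b)\<close>. This is the price of allowing points on both sides of the origin below.
\<close>
lemma fact_mult_fact_ge:
  "(real (a + b) / (2 * exp 1)) ^ (a + b) \<le> fact a * fact b"
proof -
  have "fact (a + b) = fact a * fact b * real ((a + b) choose a)"
    by (simp add: binomial_fact)
  also have "\<dots> \<le> fact a * fact b * 2 ^ (a + b)"
  proof (rule mult_left_mono)
    show "real ((a + b) choose a) \<le> 2 ^ (a + b)"
      by (metis binomial_le_pow2 of_nat_le_iff of_nat_numeral of_nat_power)
  qed simp
  finally have fact: "fact (a + b) \<le> fact a * fact b * (2::real) ^ (a + b)" .
  have "real (a + b) ^ (a + b) \<le> exp 1 ^ (a + b) * fact (a + b)"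
    by (rule power_le_exp_fact)
  also have "\<dots> \<le> exp 1 ^ (a + b) * (fact a * fact b * 2 ^ (a + b))"
    using fact by (rule mult_left_mono) simp
  finally have "real (a + b) ^ (a + b) \<le> exp 1 ^ (a + b) * (fact a * fact b * 2 ^ (a + b))" .
  then show ?thesis
    by (simp add: power_divide power_mult_distrib field_simps)
qed

text \<open>
  In increasing order, the \<open>i\<close>-th element is at least \<open>i * \<Delta>\<close>.
\<close>
lemma prod_separated_pos_ge:
  fixes T :: "real set"
  assumes "finite T" "\<Delta> > 0"
    and "\<And>t. t \<in> T \<Longrightarrow> \<Delta> \<le> t"
    and "\<And>s t. s \<in> T \<Longrightarrow> t \<in> T \<Longrightarrow> s \<noteq> t \<Longrightarrow> \<Delta> \<le> \<bar>s - t\<bar>"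
  shows "\<Delta> ^ card T * fact (card T) \<le> \<Prod>T"
proof -
  (* The bound on the maximum has to be carried along: it is what the next, larger element needs. *)
  have "(T \<noteq> {} \<longrightarrow> real (card T) * \<Delta> \<le> Max T) \<and> \<Delta> ^ card T * fact (card T) \<le> \<Prod>T"
    using assms(1,3,4)
  proof (induction T rule: finite_linorder_max_induct)
    case empty
    then show ?case by simp
  next
    case (insert b A)
    have b: "b \<notin> A" using insert.hyps by auto
    have max: "Max (insert b A) = b"
      using insert.hyps by (intro Max_eqI) (auto intro: less_imp_le)
    have IH: "A \<noteq> {} \<Longrightarrow> real (card A) * \<Delta> \<le> Max A" "\<Delta> ^ card A * fact (card A) \<le> \<Prod>A"
      using insert by auto
    have large: "real (Suc (card A)) * \<Delta> \<le> b"
    proof (cases "A = {}")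
      case True
      then show ?thesis using insert.prems by simp
    next
      case False
      then have M: "Max A \<in> A" using insert.hyps by simp
      then have "Max A < b" using insert.hyps by blast
      then show ?thesis using insert.prems(2)[of b "Max A"] M IH(1)[OF False]
        by (simp add: algebra_simps)
    qed
    have "(real (Suc (card A)) * \<Delta>) * (\<Delta> ^ card A * fact (card A)) \<le> b * \<Prod>A"
      using large IH(2) \<open>\<Delta> > 0\<close> by (intro mult_mono order_trans[OF _ large]) auto
    then show ?case
      using large b insert.hyps max by (simp add: algebra_simps)
  qed
  then show ?thesis by blast
qed

lemma prod_separated_ge:
  fixes T :: "real set"
  assumes fin: "finite T" and "\<Delta> > 0"
    and ge: "\<And>t. t \<in> T \<Longrightarrow> \<Delta> \<le> \<bar>t\<bar>"
    and sep: "\<And>s t. s \<in> T \<Longrightarrow> t \<in> T \<Longrightarrow> s \<noteq> t \<Longrightarrow> \<Delta> \<le> \<bar>s - t\<bar>"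
  shows "(\<Delta> * real (card T) / (2 * exp 1)) ^ card T \<le> (\<Prod>t\<in>T. \<bar>t\<bar>)"
proof -
  define P Q where "P = {t \<in> T. t > 0}" and "Q = uminus ` {t \<in> T. t < 0}"
  have "0 \<notin> T" using ge[of 0] \<open>\<Delta> > 0\<close> by auto
  then have T: "T = P \<union> {t \<in> T. t < 0}" "P \<inter> {t \<in> T. t < 0} = {}"
    by (auto simp: P_def) (metis linorder_neqE_linordered_idom)
  have f: "finite P" "finite Q" using fin by (auto simp: P_def Q_def)
  have "card Q = card {t \<in> T. t < 0}"
    unfolding Q_def by (rule card_image) auto
  then have card: "card T = card P + card Q"
    using T fin by (metis card_Un_disjoint finite_Un)
  have "(\<Prod>t\<in>T. \<bar>t\<bar>) = (\<Prod>t\<in>P. \<bar>t\<bar>) * (\<Prod>t\<in>{t \<in> T. t < 0}. \<bar>t\<bar>)"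
    using T fin by (metis prod.union_disjoint finite_Un)
  also have "(\<Prod>t\<in>P. \<bar>t\<bar>) = \<Prod>P"
    by (rule prod.cong) (auto simp: P_def)
  also have "(\<Prod>t\<in>{t \<in> T. t < 0}. \<bar>t\<bar>) = \<Prod>Q"
    unfolding Q_def by (subst prod.reindex) (auto intro!: prod.cong)
  finally have split: "(\<Prod>t\<in>T. \<bar>t\<bar>) = \<Prod>P * \<Prod>Q" .
  have P: "\<Delta> ^ card P * fact (card P) \<le> \<Prod>P"
    by (rule prod_separated_pos_ge[OF f(1) \<open>\<Delta> > 0\<close>]) (use ge sep in \<open>force simp: P_def\<close>)+
  have Q: "\<Delta> ^ card Q * fact (card Q) \<le> \<Prod>Q"
  proof (rule prod_separated_pos_ge[OF f(2) \<open>\<Delta> > 0\<close>])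
    show "\<Delta> \<le> t" if "t \<in> Q" for t
      using that ge by (force simp: Q_def)
    show "\<Delta> \<le> \<bar>s - t\<bar>" if "s \<in> Q" "t \<in> Q" "s \<noteq> t" for s t
      using that sep[of "- s" "- t"] by (auto simp: Q_def)
  qed
  have "(\<Delta> * real (card T) / (2 * exp 1)) ^ card T
      = \<Delta> ^ card T * (real (card T) / (2 * exp 1)) ^ card T"
    by (simp add: power_mult_distrib power_divide)
  also have "\<dots> \<le> \<Delta> ^ card T * (fact (card P) * fact (card Q))"
    using \<open>\<Delta> > 0\<close> fact_mult_fact_ge[of "card P" "card Q"] unfolding card
    by (intro mult_left_mono) auto
  also have "\<dots> = (\<Delta> ^ card P * fact (card P)) * (\<Delta> ^ card Q * fact (card Q))"
    by (simp add: card power_add)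
  also have "\<dots> \<le> \<Prod>P * \<Prod>Q"
    using \<open>\<Delta> > 0\<close> by (intro mult_mono P Q order_trans[OF _ P]) auto
  finally show ?thesis using split by simp
qed

section \<open>Eliminating frequencies by differences with step m\<close>

lemma L2_set_shift_difference_le:
  fixes h :: "nat \<Rightarrow> complex"
  assumes "cmod w \<le> 1"
  shows "L2_set (\<lambda>i. cmod (h (i + m) - w * h i)) {..<L} \<le> 2 * L2_set (\<lambda>i. cmod (h i)) {..<L + m}"
proof -
  have "L2_set (\<lambda>i. cmod (h (i + m) - w * h i)) {..<L}
      \<le> L2_set (\<lambda>i. cmod (h (i + m)) + cmod (h i)) {..<L}"
  proof (rule L2_set_mono)
    fix i
    have "cmod w * cmod (h i) \<le> cmod (h i)"
      using assms by (simp add: mult_left_le_one_le)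
    then show "cmod (h (i + m) - w * h i) \<le> cmod (h (i + m)) + cmod (h i)"
      using norm_triangle_ineq4[of "h (i + m)" "w * h i"] by (simp add: norm_mult)
  qed auto
  also have "\<dots> \<le> L2_set (\<lambda>i. cmod (h (i + m))) {..<L} + L2_set (\<lambda>i. cmod (h i)) {..<L}"
    by (rule L2_set_triangle_ineq)
  also have "L2_set (\<lambda>i. cmod (h (i + m))) {..<L} = L2_set (\<lambda>i. cmod (h i)) ((\<lambda>i. i + m) ` {..<L})"
    unfolding L2_set_def by (subst sum.reindex) auto
  also have "\<dots> \<le> L2_set (\<lambda>i. cmod (h i)) {..<L + m}"
    unfolding L2_set_def by (intro real_sqrt_le_mono sum_mono2) auto
  also have "L2_set (\<lambda>i. cmod (h i)) {..<L} \<le> L2_set (\<lambda>i. cmod (h i)) {..<L + m}"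
    unfolding L2_set_def by (intro real_sqrt_le_mono sum_mono2) auto
  finally show ?thesis by simp
qed

text \<open>
  On the sequence \<open>z j ^ i\<close> the operator of \<open>L2_set_shift_difference_le\<close> acts as multiplication by
  \<open>z j ^ m - w\<close>, so that composing these operators over \<open>K\<close> produces the sum on the left.
\<close>
lemma L2_set_eliminate_le:
  fixes c z :: "'a \<Rightarrow> complex" and w :: "'b \<Rightarrow> complex"
  assumes "finite K" "\<And>k. k \<in> K \<Longrightarrow> cmod (w k) \<le> 1"
  shows "L2_set (\<lambda>i. cmod (\<Sum>j\<in>J. c j * (\<Prod>k\<in>K. z j ^ m - w k) * z j ^ i)) {..<L}
       \<le> 2 ^ card K * L2_set (\<lambda>i. cmod (\<Sum>j\<in>J. c j * z j ^ i)) {..<L + m * card K}"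
  using assms
proof (induction K arbitrary: L rule: finite_induct)
  case empty
  then show ?case by simp
next
  case (insert a K)
  define h where "h i = (\<Sum>j\<in>J. c j * (\<Prod>k\<in>K. z j ^ m - w k) * z j ^ i)" for i
  have "(\<Sum>j\<in>J. c j * (\<Prod>k\<in>insert a K. z j ^ m - w k) * z j ^ i) = h (i + m) - w a * h i" for i
    using insert.hyps
    by (simp add: h_def sum_distrib_left algebra_simps power_add flip: sum_subtractf)
  then have "L2_set (\<lambda>i. cmod (\<Sum>j\<in>J. c j * (\<Prod>k\<in>insert a K. z j ^ m - w k) * z j ^ i)) {..<L}
      \<le> 2 * L2_set (\<lambda>i. cmod (h i)) {..<L + m}"
    using L2_set_shift_difference_le[of "w a"] insert.prems by simp
  also have "\<dots> \<le> 2 * (2 ^ card K * L2_set (\<lambda>i. cmod (\<Sum>j\<in>J. c j * z j ^ i)) {..<L + m + m * card K})"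
    unfolding h_def using insert by (intro mult_left_mono) auto
  finally show ?case using insert.hyps by (simp add: algebra_simps)
qed

text \<open>
  Eliminating all nodes but \<open>z j\<close> leaves a geometric sequence of constant modulus, whose norm over a
  window of length \<open>L\<close> is known exactly.
\<close>
lemma cmod_coeff_mult_prod_le:
  fixes c z :: "'a \<Rightarrow> complex"
  assumes fin: "finite J" and j: "j \<in> J" and unit: "\<And>k. k \<in> J \<Longrightarrow> cmod (z k) = 1"
  shows "cmod (c j) * (\<Prod>k\<in>J - {j}. cmod (z j ^ m - z k ^ m)) * sqrt (real L)
       \<le> 2 ^ (card J - 1) * L2_set (\<lambda>i. cmod (\<Sum>k\<in>J. c k * z k ^ i)) {..<L + m * (card J - 1)}"
proof -
  let ?p = "\<lambda>i. \<Prod>k\<in>J - {j}. z i ^ m - z k ^ m"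
  have vanish: "?p i = 0" if "i \<in> J - {j}" for i
    using that fin by (auto intro!: prod_zero)
  have "(\<Sum>i\<in>J. c i * ?p i * z i ^ n) = c j * ?p j * z j ^ n" for n
    using fin j vanish by (subst sum.remove[OF fin j]) (auto intro!: sum.neutral)
  then have "cmod (\<Sum>i\<in>J. c i * ?p i * z i ^ n) = cmod (c j) * (\<Prod>k\<in>J - {j}. cmod (z j ^ m - z k ^ m))" for n
    using unit[OF j] by (simp add: norm_mult norm_power prod_norm)
  then have "L2_set (\<lambda>n. cmod (\<Sum>i\<in>J. c i * ?p i * z i ^ n)) {..<L}
      = cmod (c j) * (\<Prod>k\<in>J - {j}. cmod (z j ^ m - z k ^ m)) * sqrt (real L)"
    by (simp add: L2_set_def real_sqrt_mult prod_nonneg mult.commute)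
  moreover have "card (J - {j}) = card J - 1" using j by simp
  ultimately show ?thesis
    using L2_set_eliminate_le[of "J - {j}" "\<lambda>k. z k ^ m" c z m J L] fin unit
    by (simp add: norm_power)
qed

section \<open>Wrap-around distances and chords\<close>

lemma abs_Arg_exp_le: "\<bar>Arg (exp (\<i> * complex_of_real t))\<bar> \<le> \<bar>t\<bar>"
proof (cases "\<bar>t\<bar> < pi")
  case True
  then have "Arg (exp (\<i> * complex_of_real t)) = t"
    by (intro Arg_unique[of 1]) auto
  then show ?thesis by simp
next
  case False
  then show ?thesis
    using Arg_le_pi[of "exp (\<i> * complex_of_real t)"] mpi_less_Arg[of "exp (\<i> * complex_of_real t)"]
    by linarith
qed

text \<open>Jordan's inequality, from the concavity of the sine on \<open>{0..pi}\<close>.\<close>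
lemma sin_ge_chord:
  assumes "0 \<le> x" "x \<le> pi / 2"
  shows "2 * x / pi \<le> sin x"
proof -
  have "convex_on {0..pi} (\<lambda>x. - sin x)"
  proof (rule f''_ge0_imp_convex)
    show "((\<lambda>x. - sin x) has_real_derivative - cos x) (at x)" for x :: real
      by (auto intro!: derivative_eq_intros)
    show "((\<lambda>x. - cos x) has_real_derivative sin x) (at x)" for x :: real
      by (auto intro!: derivative_eq_intros)
  qed (auto simp: sin_ge_zero)
  from convex_onD[OF this, of "2 * x / pi" 0 "pi / 2"] assms
  show ?thesis by (simp add: field_simps)
qed

text \<open>
  The chord has length \<open>2 * \<bar>sin (m * t / 2)\<bar>\<close>, where \<open>t\<close> is the principal argument of the quotient.
  The hypothesis keeps half the angle in the range where the sine lies above its secant.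
\<close>
lemma cmod_exp_power_diff_ge:
  assumes "real m * wrap_dist x y \<le> pi"
  shows "2 * real m / pi * wrap_dist x y
       \<le> cmod (exp (\<i> * complex_of_real x) ^ m - exp (\<i> * complex_of_real y) ^ m)"
proof -
  define t where "t = Arg (exp (\<i> * complex_of_real (x - y)))"
  have t: "exp (\<i> * complex_of_real t) = exp (\<i> * complex_of_real (x - y))"
    using Arg_eq[of "exp (\<i> * complex_of_real (x - y))"] by (simp add: t_def)
  have w: "wrap_dist x y = \<bar>t\<bar>" by (simp add: wrap_dist_def t_def)
  have "exp (\<i> * complex_of_real x) = exp (\<i> * complex_of_real y) * exp (\<i> * complex_of_real t)"
    unfolding t exp_add[symmetric] by (simp add: algebra_simps)
  then have "exp (\<i> * complex_of_real x) ^ m - exp (\<i> * complex_of_real y) ^ m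
      = exp (\<i> * complex_of_real y) ^ m * (exp (\<i> * complex_of_real t) ^ m - 1)"
    by (simp add: power_mult_distrib algebra_simps)
  also have "exp (\<i> * complex_of_real t) ^ m = exp (\<i> * complex_of_real (real m * t))"
    by (simp add: mult.left_commute flip: exp_of_nat_mult)
  finally have "cmod (exp (\<i> * complex_of_real x) ^ m - exp (\<i> * complex_of_real y) ^ m)
      = 2 * \<bar>sin (real m * t / 2)\<bar>"
    by (simp add: norm_mult norm_power dist_exp_i_1 del: of_real_mult)
  also have "\<bar>sin (real m * t / 2)\<bar> = \<bar>sin (real m * \<bar>t\<bar> / 2)\<bar>"
    by (simp add: abs_if)
  also have "2 * (2 * (real m * \<bar>t\<bar> / 2) / pi) \<le> 2 * \<bar>sin (real m * \<bar>t\<bar> / 2)\<bar>"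
    using sin_ge_chord[of "real m * \<bar>t\<bar> / 2"] assms w by (simp add: abs_le_iff)
  finally show ?thesis by (simp add: w)
qed

text \<open>
  Principal arguments relative to \<open>x\<close> turn the circle into a line without decreasing separation: the
  wrap-around distance is the smallest modulus among all differences of arguments
  (\<open>abs_Arg_exp_le\<close>).
\<close>
lemma prod_wrap_dist_ge:
  assumes fin: "finite Y" and "\<Delta> > 0"
    and ge: "\<And>y. y \<in> Y \<Longrightarrow> \<Delta> \<le> wrap_dist x y"
    and sep: "\<And>y y'. y \<in> Y \<Longrightarrow> y' \<in> Y \<Longrightarrow> y \<noteq> y' \<Longrightarrow> \<Delta> \<le> wrap_dist y y'"
  shows "(\<Delta> * real (card Y) / (2 * exp 1)) ^ card Y \<le> (\<Prod>y\<in>Y. wrap_dist x y)"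
proof -
  define t where "t y = Arg (exp (\<i> * complex_of_real (x - y)))" for y
  have t: "exp (\<i> * complex_of_real (t y)) = exp (\<i> * complex_of_real (x - y))" for y
    using Arg_eq[of "exp (\<i> * complex_of_real (x - y))"] by (simp add: t_def)
  have w: "wrap_dist x y = \<bar>t y\<bar>" for y
    by (simp add: wrap_dist_def t_def)
  have "wrap_dist y y' \<le> \<bar>t y' - t y\<bar>" for y y'
  proof -
    have "exp (\<i> * complex_of_real (t y' - t y)) = exp (\<i> * complex_of_real (t y')) / exp (\<i> * complex_of_real (t y))"
      by (simp add: right_diff_distrib exp_diff)
    also have "\<dots> = exp (\<i> * complex_of_real (y - y'))"
      unfolding t exp_diff[symmetric] by (simp add: algebra_simps)
    finally show ?thesis
      using abs_Arg_exp_le[of "t y' - t y"] unfolding wrap_dist_def by metis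
  qed
  then have sep': "\<Delta> \<le> \<bar>t y - t y'\<bar>" if "y \<in> Y" "y' \<in> Y" "y \<noteq> y'" for y y'
    using sep that by (metis order_trans)
  have inj: "inj_on t Y"
  proof (rule inj_onI, rule ccontr)
    fix y y' assume "y \<in> Y" "y' \<in> Y" "t y = t y'" "y \<noteq> y'"
    then show False using sep'[of y y'] \<open>\<Delta> > 0\<close> by simp
  qed
  have "(\<Delta> * real (card (t ` Y)) / (2 * exp 1)) ^ card (t ` Y) \<le> (\<Prod>s\<in>t ` Y. \<bar>s\<bar>)"
    by (rule prod_separated_ge) (use fin \<open>\<Delta> > 0\<close> ge sep' w in auto)
  then show ?thesis
    by (simp add: card_image inj prod.reindex w)
qed

section \<open>The smallest singular value\<close>

text \<open>
  The base \<open>8 * pi * exp 1\<close> collects, for each node other than \<open>x\<close>: a factor 2 for the norm of the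
  difference operator, \<open>pi / 2\<close> for the comparison of chord and arc, 4 for \<open>m\<close> being possibly as
  small as \<open>N / (4 * n)\<close>, and \<open>2 * exp 1\<close> from the product of the distances.
\<close>
lemma clustered_coeff_le:
  fixes c :: "real \<Rightarrow> complex"
  assumes cl: "clustered \<Delta> (Suc n) \<tau> X" and x: "x \<in> X"
    and N: "2 * n \<le> N" and N\<tau>: "\<tau> = 0 \<or> real N \<le> 2 * pi / (\<tau> * \<Delta>)"
  shows "cmod (c x) * (sqrt (real N / 2) * (real N * \<Delta> / (8 * pi * exp 1)) ^ n)
       \<le> L2_set (\<lambda>k. cmod (\<Sum>y\<in>X. c y * exp (\<i> * complex_of_real y) ^ k)) {..N}"
proof -
  define m where "m = N div (2 * n)"
  define L where "L = N + 1 - m * n"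
  have X: "finite X" "card X = Suc n" and \<Delta>: "\<Delta> > 0" and \<tau>: "real n \<le> \<tau>"
    and d: "\<And>y y'. y \<in> X \<Longrightarrow> y' \<in> X \<Longrightarrow> y \<noteq> y' \<Longrightarrow> \<Delta> \<le> wrap_dist y y' \<and> wrap_dist y y' \<le> \<tau> * \<Delta>"
    using cl by (auto simp: clustered_def)
  have card: "card (X - {x}) = n" using X x by simp
  have mn: "2 * (m * n) \<le> N"
    unfolding m_def using div_times_less_eq_dividend[of N "2 * n"] by (simp add: algebra_simps)
  have LN: "L + m * n = N + 1" "real N / 2 \<le> real L"
    using mn unfolding L_def by linarith+
  have factor: "2 * real m / pi * wrap_dist x y
      \<le> cmod (exp (\<i> * complex_of_real x) ^ m - exp (\<i> * complex_of_real y) ^ m)" if y: "y \<in> X - {x}" for y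
  proof (rule cmod_exp_power_diff_ge)
    have n: "n \<ge> 1" using card y X by (metis One_nat_def Suc_leI card_gt_0_iff empty_iff finite_Diff)
    then have "\<tau> > 0" using \<tau> by linarith
    then have "real N * (\<tau> * \<Delta>) \<le> 2 * pi"
      using N\<tau> \<Delta> by (simp add: field_simps)
    moreover have "2 * m \<le> 2 * (m * n)" using n by simp
    then have "2 * real m \<le> real N" using mn by linarith
    then have "2 * real m * (\<tau> * \<Delta>) \<le> real N * (\<tau> * \<Delta>)"
      using \<open>\<tau> > 0\<close> \<Delta> by (intro mult_right_mono) auto
    moreover have "real m * wrap_dist x y \<le> real m * (\<tau> * \<Delta>)"
      using d[OF x, of y] y by (intro mult_left_mono) auto
    ultimately show "real m * wrap_dist x y \<le> pi" by linarith
  qed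
  (* m is at least 1, so rounding down at most halves N / (2 * n). *)
  have base: "real N * \<Delta> / (4 * pi * exp 1) \<le> 2 * real m / pi * (\<Delta> * real n / (2 * exp 1))"
    if n: "n \<noteq> 0"
  proof -
    have "N < 2 * n * (m + 1)"
      unfolding m_def using n div_less_iff_less_mult[of "2 * n" N "N div (2 * n) + 1"] by (simp add: mult.commute)
    moreover have "1 \<le> m" unfolding m_def using n N by (simp add: div_greater_zero_iff Suc_le_eq)
    then have "2 * n * (m + 1) \<le> 4 * (n * m)" by (simp add: algebra_simps)
    ultimately have "real N \<le> 4 * (real n * real m)"
      by (metis less_imp_le of_nat_le_iff of_nat_mult of_nat_numeral order_less_le_trans)
    then have "real N * \<Delta> \<le> 4 * (real n * real m) * \<Delta>"
      using \<Delta> by (intro mult_right_mono) auto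
    then show ?thesis by (simp add: field_simps)
  qed
  have "(real N * \<Delta> / (4 * pi * exp 1)) ^ n
      \<le> (2 * real m / pi * (\<Delta> * real n / (2 * exp 1))) ^ n"
    using base \<Delta> by (cases "n = 0") (auto intro!: power_mono)
  also have "\<dots> = (2 * real m / pi) ^ n * (\<Delta> * real n / (2 * exp 1)) ^ n"
    by (rule power_mult_distrib)
  also have "\<dots> \<le> (2 * real m / pi) ^ n * (\<Prod>y\<in>X - {x}. wrap_dist x y)"
  proof (rule mult_left_mono)
    show "(\<Delta> * real n / (2 * exp 1)) ^ n \<le> (\<Prod>y\<in>X - {x}. wrap_dist x y)"
      using prod_wrap_dist_ge[of "X - {x}" \<Delta> x] X(1) \<Delta> d x unfolding card by auto
  qed auto
  also have "\<dots> = (\<Prod>y\<in>X - {x}. 2 * real m / pi * wrap_dist x y)"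
    by (simp only: prod.distrib prod_constant card)
  also have "\<dots> \<le> (\<Prod>y\<in>X - {x}. cmod (exp (\<i> * complex_of_real x) ^ m - exp (\<i> * complex_of_real y) ^ m))"
    using factor by (intro prod_mono) (auto simp: wrap_dist_def)
  finally have P: "(real N * \<Delta> / (4 * pi * exp 1)) ^ n \<le> \<dots>" .
  have "2 ^ n * (cmod (c x) * (sqrt (real N / 2) * (real N * \<Delta> / (8 * pi * exp 1)) ^ n))
      = cmod (c x) * (real N * \<Delta> / (4 * pi * exp 1)) ^ n * sqrt (real N / 2)"
    by (simp add: power_divide power_mult_distrib field_simps flip: power_mult_distrib)
  also have "\<dots> \<le> cmod (c x)
      * (\<Prod>y\<in>X - {x}. cmod (exp (\<i> * complex_of_real x) ^ m - exp (\<i> * complex_of_real y) ^ m)) * sqrt (real L)"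
    using P LN(2) \<Delta> by (intro mult_mono) (auto intro!: mult_nonneg_nonneg prod_nonneg)
  also have "\<dots> \<le> 2 ^ n * L2_set (\<lambda>k. cmod (\<Sum>y\<in>X. c y * exp (\<i> * complex_of_real y) ^ k)) {..<N + 1}"
    using cmod_coeff_mult_prod_le[OF X(1) x, of "\<lambda>y. exp (\<i> * complex_of_real y)" c m L] X LN(1)
    by simp
  finally show ?thesis
    by (simp add: lessThan_Suc_atMost)
qed

text \<open>
  Indexing the coefficients by the nodes themselves removes the enumeration of the nodes.
\<close>
lemma norm2_vandermonde_mult:
  assumes "distinct xs" "dim_vec c = length xs"
  shows "norm2 (vandermonde N xs *\<^sub>v c)
       = L2_set (\<lambda>k. cmod (\<Sum>y\<in>set xs. c $ inv_into {..<length xs} ((!) xs) y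
             * exp (\<i> * complex_of_real y) ^ k)) {..N}"
proof -
  let ?f = "(!) xs"
  have bij: "bij_betw ?f {..<length xs} (set xs)"
    using assms(1) by (simp add: bij_betw_nth)
  have "(vandermonde N xs *\<^sub>v c) $ k = (\<Sum>y\<in>set xs. c $ inv_into {..<length xs} ?f y
             * exp (\<i> * complex_of_real y) ^ k)" if "k \<le> N" for k
  proof -
    have "(vandermonde N xs *\<^sub>v c) $ k
        = (\<Sum>j<length xs. exp (\<i> * of_nat k * complex_of_real (xs ! j)) * c $ j)"
      using that assms by (simp add: vandermonde_def scalar_prod_def lessThan_atLeast0)
    also have "\<dots> = (\<Sum>j<length xs. c $ inv_into {..<length xs} ?f (xs ! j)
             * exp (\<i> * complex_of_real (xs ! j)) ^ k)"
      using bij_betw_imp_inj_on[OF bij]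
      by (intro sum.cong) (auto simp: mult_ac simp flip: exp_of_nat_mult)
    also have "\<dots> = (\<Sum>y\<in>set xs. c $ inv_into {..<length xs} ?f y * exp (\<i> * complex_of_real y) ^ k)"
      by (rule sum.reindex_bij_betw[OF bij])
    finally show ?thesis .
  qed
  moreover have "{..<dim_vec (vandermonde N xs *\<^sub>v c)} = {..N}"
    by (auto simp: vandermonde_def)
  ultimately show ?thesis
    unfolding norm2_def by (intro L2_set_cong) auto
qed

lemma sqrt_Suc_le_power4: "sqrt (real (Suc n)) \<le> 4 ^ n"
proof -
  have "sqrt (real (Suc n)) \<le> real (Suc n)"
    by (rule real_le_lsqrt) (auto simp: power2_eq_square)
  also have "\<dots> \<le> 2 ^ n"
    by (metis Suc_leI less_exp of_nat_le_iff of_nat_numeral of_nat_power)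
  also have "\<dots> \<le> 4 ^ n" by (rule power_mono) auto
  finally show ?thesis .
qed

theorem theorem2p1:
  shows "\<exists>(C1 :: nat \<Rightarrow> real) (C3 :: real).
    (\<forall>l\<ge>1. C1 l > 0) \<and> C3 > 0 \<and>
    (\<forall>(l :: nat) (\<Delta> :: real) (\<tau> :: real) (xs :: real list) (N :: nat).
       l \<ge> 1 \<longrightarrow> distinct xs \<longrightarrow> clustered \<Delta> l \<tau> (set xs) \<longrightarrow>
       C1 l \<le> real N \<longrightarrow> (\<tau> = 0 \<or> real N \<le> 2 * pi / (\<tau> * \<Delta>)) \<longrightarrow>
       sigma_min (vandermonde N xs) \<ge>
         C3 * sqrt (real N) * (real N * \<Delta> / (32 * pi * exp 1)) ^ (l - 1))"
proof (intro exI[of _ "\<lambda>l. 2 * real l"] exI[of _ "1 / sqrt 2"] conjI allI impI)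
  (* For l \<ge> 2, the bound N \<ge> 2 * l makes the step of the difference operators at least 1. *)
  fix l :: nat and \<Delta> \<tau> :: real and xs :: "real list" and N :: nat
  assume l: "l \<ge> 1" and xs: "distinct xs" and cl: "clustered \<Delta> l \<tau> (set xs)"
    and N: "2 * real l \<le> real N" and N\<tau>: "\<tau> = 0 \<or> real N \<le> 2 * pi / (\<tau> * \<Delta>)"
  define n where "n = l - 1"
  have ln: "l = Suc n" using l by (simp add: n_def)
  have len: "length xs = l" and \<Delta>: "\<Delta> > 0"
    using cl xs by (auto simp: clustered_def distinct_card)
  have dim: "dim_col (vandermonde N xs) = l"
    by (simp add: vandermonde_def len)
  obtain c where c: "c \<in> carrier_vec l" "norm2 c = 1"
    and \<sigma>: "sigma_min (vandermonde N xs) = norm2 (vandermonde N xs *\<^sub>v c)"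
    using sigma_min_attained[of "vandermonde N xs"] l unfolding dim by auto
  define b where "b = sqrt (real N / 2) * (real N * \<Delta> / (8 * pi * exp 1)) ^ n"
  define s where "s = norm2 (vandermonde N xs *\<^sub>v c)"
  have b: "b \<ge> 0" using \<Delta> by (simp add: b_def)
  have coeff: "cmod (c $ j) * b \<le> s" if j: "j < l" for j
  proof -
    have "inv_into {..<length xs} ((!) xs) (xs ! j) = j"
      using j len xs by (intro inv_into_f_f) (auto simp: inj_on_nth)
    then show ?thesis
      using clustered_coeff_le[of \<Delta> n \<tau> "set xs" "xs ! j" N "\<lambda>y. c $ inv_into {..<length xs} ((!) xs) y"]
        cl j len N N\<tau> ln norm2_vandermonde_mult[OF xs, of c N] c(1)
      by (simp add: b_def s_def)
  qed
  have "b = L2_set (\<lambda>j. b * cmod (c $ j)) {..<l}"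
    using c b by (simp add: norm2_def flip: L2_set_right_distrib)
  also have "\<dots> \<le> L2_set (\<lambda>j. s) {..<l}"
    using coeff b by (intro L2_set_mono) (auto simp: mult.commute)
  also have "\<dots> = sqrt (real l) * s"
    using L2_set_nonneg by (simp add: L2_set_def real_sqrt_mult s_def norm2_def sum_nonneg)
  also have "\<dots> \<le> 4 ^ n * s"
    using sqrt_Suc_le_power4[of n] unfolding ln
    by (intro mult_right_mono) (auto simp: s_def norm2_def)
  finally have "b \<le> 4 ^ n * s" .
  moreover have "4 ^ n * (1 / sqrt 2 * sqrt (real N) * (real N * \<Delta> / (32 * pi * exp 1)) ^ n) = b"
    by (simp add: b_def real_sqrt_divide power_divide field_simps flip: power_mult_distrib)
  ultimately show "1 / sqrt 2 * sqrt (real N) * (real N * \<Delta> / (32 * pi * exp 1)) ^ (l - 1)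
      \<le> sigma_min (vandermonde N xs)"
    unfolding \<sigma> s_def[symmetric] n_def[symmetric]
    by (metis mult_le_cancel_left_pos zero_less_numeral zero_less_power)
qed auto

end
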